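(* For each integer $n\ge 1$, we have $\mu(n)\ge f(n)$, where $f(n)=\left\lceil \frac{1}{2}\left(\sqrt{4n-3}-1\right)\right\rceil$ and $\mu(n)$ is the $n$th mediation number.
   Context: Digraphs are finite, without loops or parallel arcs (both arcs $xy$ and $yx$ may be present). For a digraph $D$ with vertex set $V(D)$ and arc set $A(D)$, and $x\in V(D)$, let $N^-(x)=\{y\in V(D): yx\in A(D)\}$ be the set of in-neighbors of $x$, let $N^-[x]=\{x\}\cup N^-(x)$ be the closed in-neighborhood, and call $|N^-(x)|$ the in-degree of $x$. $\Delta^-(D)$ denotes the maximum in-degree of a vertex of $D$. A digraph $D$ is mediated if for every pair $x,y$ of distinct vertices there is a vertex $z$ (possibly $z=x$ or $z=y$) such that $x,y\in N^-[z]$. For $n\ge 1$, the $n$th mediation number $\mu(n)$ is the minimum of $\Delta^-(D)$ over all mediated digraphs $D$ on $n$ vertices. *)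

theory Defs
  imports Complex_Main "Graph_Theory.Pair_Digraph"
begin

definition in_nbrs :: "'a pair_pre_digraph \<Rightarrow> 'a \<Rightarrow> 'a set" where
  "in_nbrs D x = {y \<in> pverts D. (y, x) \<in> parcs D}"

definition closed_in_nbrs :: "'a pair_pre_digraph \<Rightarrow> 'a \<Rightarrow> 'a set" where
  "closed_in_nbrs D x = insert x (in_nbrs D x)"

definition max_in_degree :: "'a pair_pre_digraph \<Rightarrow> nat" where
  "max_in_degree D = Max (in_degree (with_proj D) ` pverts D)"

definition mediated :: "'a pair_pre_digraph \<Rightarrow> bool" where
  "mediated D \<longleftrightarrow> (\<forall>x \<in> pverts D. \<forall>y \<in> pverts D. x \<noteq> y \<longrightarrow>
     (\<exists>z \<in> pverts D. x \<in> closed_in_nbrs D z \<and> y \<in> closed_in_nbrs D z))"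

(* Natural numbers as vertices are no restriction: see mediation_number_le, which holds for
   an arbitrary vertex type. By mediation_number_attained the infimum is a minimum for n > 0. *)
definition mediation_number :: "nat \<Rightarrow> nat" where
  "mediation_number n = Inf {max_in_degree D | D :: nat pair_pre_digraph.
     pair_digraph D \<and> mediated D \<and> card (pverts D) = n}"

lemma in_degree_eq_card_in_nbrs:
  assumes "pair_digraph D"
  shows "in_degree (with_proj D) x = card (in_nbrs D x)"
proof -
  interpret pair_digraph D by fact
  have "in_arcs (with_proj D) x = (\<lambda>y. (y, x)) ` in_nbrs D x"
    by (auto simp: in_arcs_def in_nbrs_def dest: wellformed')
  then show ?thesis
    by (simp add: in_degree_def card_image inj_on_def)
qed

lemma mediation_number_attained:
  assumes "n \<ge> 1"
  shows "\<exists>D :: nat pair_pre_digraph. pair_digraph D \<and> mediated D \<and> card (pverts D) = n \<and>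
     max_in_degree D = mediation_number n"
proof -
  define D :: "nat pair_pre_digraph" where
    "D = \<lparr>pverts = {..<n}, parcs = {(x, y). x < n \<and> y < n \<and> x \<noteq> y}\<rparr>"
  have fin: "finite {(x, y). x < n \<and> y < n \<and> x \<noteq> y}"
    by (rule finite_subset[of _ "{..<n} \<times> {..<n}"]) auto
  have "pair_digraph D"
    by unfold_locales (use fin in \<open>auto simp: D_def\<close>)
  moreover have "mediated D"
    by (auto simp: mediated_def closed_in_nbrs_def in_nbrs_def D_def)
  moreover have "card (pverts D) = n"
    by (simp add: D_def)
  ultimately have "max_in_degree D \<in> {max_in_degree D | D :: nat pair_pre_digraph.
     pair_digraph D \<and> mediated D \<and> card (pverts D) = n}"
    by blast
  then have "mediation_number n \<in> {max_in_degree D | D :: nat pair_pre_digraph.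
     pair_digraph D \<and> mediated D \<and> card (pverts D) = n}"
    unfolding mediation_number_def by (intro Inf_nat_def1) blast
  then show ?thesis by force
qed

lemma mediation_number_le:
  fixes D :: "'a pair_pre_digraph"
  assumes "pair_digraph D" "mediated D"
  shows "mediation_number (card (pverts D)) \<le> max_in_degree D"
proof -
  interpret pair_digraph D by fact
  obtain f :: "'a \<Rightarrow> nat" where f: "inj_on f (pverts D)"
    using finite_imp_inj_to_nat_seg[OF pair_finite_verts] by blast
  define E :: "nat pair_pre_digraph" where
    "E = \<lparr>pverts = f ` pverts D, parcs = map_prod f f ` parcs D\<rparr>"
  have inj: "f x = f y \<longleftrightarrow> x = y" if "x \<in> pverts D" "y \<in> pverts D" for x y
    using f that by (auto simp: inj_on_def)
  have E: "pair_digraph E"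
  proof unfold_locales
    show "fst e \<noteq> snd e" if "e \<in> parcs E" for e
    proof -
      from that obtain d where d: "d \<in> parcs D" "e = map_prod f f d"
        by (auto simp: E_def)
      then show ?thesis
        using inj[of "fst d" "snd d"] arc_fst_in_verts arc_snd_in_verts pair_no_loops by simp
    qed
  qed (auto simp: E_def pair_finite_verts pair_finite_arcs dest: wellformed')
  have nbrs: "in_nbrs E (f x) = f ` in_nbrs D x" if x: "x \<in> pverts D" for x
  proof
    show "in_nbrs E (f x) \<subseteq> f ` in_nbrs D x"
    proof
      fix u assume "u \<in> in_nbrs E (f x)"
      then obtain a b where ab: "(a, b) \<in> parcs D" "u = f a" "f x = f b"
        by (auto simp: in_nbrs_def E_def)
      then have "x = b" "a \<in> pverts D"
        using inj[of x b] x wellformed' by blast+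
      with ab show "u \<in> f ` in_nbrs D x"
        by (simp add: in_nbrs_def)
    qed
    show "f ` in_nbrs D x \<subseteq> in_nbrs E (f x)"
      by (force simp: in_nbrs_def E_def)
  qed
  have clo: "closed_in_nbrs E (f x) = f ` closed_in_nbrs D x" if "x \<in> pverts D" for x
    using nbrs[OF that] by (simp add: closed_in_nbrs_def)
  have vE: "pverts E = f ` pverts D"
    by (simp add: E_def)
  have "mediated E"
    unfolding mediated_def
  proof (intro ballI impI)
    fix u v assume "u \<in> pverts E" "v \<in> pverts E" "u \<noteq> v"
    then obtain x y where xy: "x \<in> pverts D" "y \<in> pverts D" "x \<noteq> y" "u = f x" "v = f y"
      unfolding vE by blast
    then obtain z where "z \<in> pverts D" "x \<in> closed_in_nbrs D z" "y \<in> closed_in_nbrs D z"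
      using assms(2) unfolding mediated_def by blast
    then show "\<exists>z\<in>pverts E. u \<in> closed_in_nbrs E z \<and> v \<in> closed_in_nbrs E z"
      using xy clo unfolding vE by blast
  qed
  moreover have "card (pverts E) = card (pverts D)"
    unfolding vE by (rule card_image[OF f])
  moreover have "max_in_degree E = max_in_degree D"
  proof -
    have "in_degree (with_proj E) (f x) = in_degree (with_proj D) x" if "x \<in> pverts D" for x
    proof -
      have "inj_on f (in_nbrs D x)"
        using f by (rule inj_on_subset) (auto simp: in_nbrs_def)
      then show ?thesis
        using that E assms(1) nbrs by (simp add: in_degree_eq_card_in_nbrs card_image)
    qed
    then show ?thesis
      unfolding max_in_degree_def vE image_image by (simp cong: image_cong)
  qed
  ultimately have "max_in_degree D \<in> {max_in_degree D' | D' :: nat pair_pre_digraph.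
     pair_digraph D' \<and> mediated D' \<and> card (pverts D') = card (pverts D)}"
    using E by (intro CollectI exI[of _ E]) simp
  then show ?thesis
    unfolding mediation_number_def by (rule cInf_lower) simp
qed

end

theory Submission
  imports Defs
begin

(* Double counting: every ordered pair of distinct vertices lies in some closed in-neighbourhood,
   and each of the n closed in-neighbourhoods contains at most (d + 1) d such pairs, where d is
   the maximum in-degree. Hence n (n - 1) \<le> n (d + 1) d, that is, 4 n - 3 \<le> (2 d + 1)^2. *)

lemma card_Times_diff_Id:
  assumes "finite A"
  shows "card (A \<times> A - Id) = card A * (card A - 1)"
proof -
  \<comment> \<open>Fibring over the first coordinate leaves the same number of choices for the
    second each time, so the cardinality becomes a constant sum.\<close>
  have "A \<times> A - Id = Sigma A (\<lambda>x. A - {x})"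
    by auto
  then show ?thesis
    using assms by simp
qed

lemma card_closed_in_nbrs_le:
  assumes "pair_digraph D" "z \<in> pverts D"
  shows "card (closed_in_nbrs D z) \<le> max_in_degree D + 1"
proof -
  interpret pair_digraph D by fact
  have "card (in_nbrs D z) \<le> max_in_degree D"
    unfolding max_in_degree_def in_degree_eq_card_in_nbrs[OF assms(1)]
    using assms(2) pair_finite_verts by (intro Max_ge) auto
  then show ?thesis
    using card_insert_le_m1[of "max_in_degree D + 1" "in_nbrs D z" z]
    by (simp add: closed_in_nbrs_def)
qed

text \<open>For a nonempty digraph this is the bound by f(n) solved for n instead of d, which keeps
  the counting argument within the natural numbers.\<close>

lemma mediated_card_verts_le:
  assumes "pair_digraph D" "mediated D"
  shows "card (pverts D) \<le> max_in_degree D * (max_in_degree D + 1) + 1"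
proof -
  interpret pair_digraph D by fact
  let ?V = "pverts D" and ?d = "max_in_degree D" and ?C = "closed_in_nbrs D"
  have fin: "finite ?V" by (rule pair_finite_verts)
  have finC: "finite (?C z)" for z
    using fin by (simp add: closed_in_nbrs_def in_nbrs_def)
  have "card ?V * (card ?V - 1) = card (?V \<times> ?V - Id)"
    using fin by (simp add: card_Times_diff_Id)
  also have "\<dots> \<le> card (\<Union>z\<in>?V. ?C z \<times> ?C z - Id)"
  proof (rule card_mono)
    show "finite (\<Union>z\<in>?V. ?C z \<times> ?C z - Id)"
      using fin finC by blast
    show "?V \<times> ?V - Id \<subseteq> (\<Union>z\<in>?V. ?C z \<times> ?C z - Id)"
    proof (rule subsetI)
      fix p assume p: "p \<in> ?V \<times> ?V - Id"
      obtain x y where xy: "p = (x, y)" by (cases p)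
      with p have "x \<in> ?V" "y \<in> ?V" "x \<noteq> y" by auto
      then obtain z where "z \<in> ?V" "x \<in> ?C z" "y \<in> ?C z"
        using assms(2) unfolding mediated_def by blast
      with xy \<open>x \<noteq> y\<close> show "p \<in> (\<Union>z\<in>?V. ?C z \<times> ?C z - Id)" by auto
    qed
  qed
  also have "\<dots> \<le> (\<Sum>z\<in>?V. card (?C z \<times> ?C z - Id))"
    by (rule card_UN_le[OF fin])
  also have "\<dots> \<le> (\<Sum>z\<in>?V. (?d + 1) * ?d)"
  proof (rule sum_mono)
    fix z assume "z \<in> ?V"
    then have "card (?C z) \<le> ?d + 1"
      by (rule card_closed_in_nbrs_le[OF assms(1)])
    \<comment> \<open>k (k - 1) is monotone in k, also with truncated subtraction.\<close>
    then have "card (?C z) * (card (?C z) - 1) \<le> (?d + 1) * ?d"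
      by (intro mult_le_mono) auto
    then show "card (?C z \<times> ?C z - Id) \<le> (?d + 1) * ?d"
      by (simp add: card_Times_diff_Id finC)
  qed
  also have "\<dots> = card ?V * ((?d + 1) * ?d)"
    by simp
  \<comment> \<open>The common factor \<open>card ?V\<close> can be cancelled only if it is nonzero;
    for the empty digraph the claim is trivial.\<close>
  finally have "card ?V = 0 \<or> card ?V - 1 \<le> (?d + 1) * ?d"
    by (simp only: mult_le_cancel1) auto
  then show ?thesis
    by (auto simp: mult.commute)
qed

theorem proposition3p1:
  fixes n :: nat
  assumes "n \<ge> 1"
  shows "int (mediation_number n) \<ge> \<lceil>1 / 2 * (sqrt (4 * real n - 3) - 1)\<rceil>"
proof -
  define d where "d = mediation_number n"
  \<comment> \<open>Since n \<ge> 1, the infimum is attained, so \<open>d\<close> is the maximum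
    in-degree of an actual mediated digraph.\<close>
  obtain D :: "nat pair_pre_digraph" where
    "pair_digraph D" "mediated D" "card (pverts D) = n" "max_in_degree D = d"
    using mediation_number_attained[OF assms] unfolding d_def by blast
  then have "n \<le> d * (d + 1) + 1"
    using mediated_card_verts_le[of D] by simp
  then have "real n \<le> real (d * (d + 1) + 1)"
    by (simp only: of_nat_le_iff)
  \<comment> \<open>Completing the square: 4 (d (d + 1) + 1) - 3 = (2 d + 1)^2.\<close>
  then have "4 * real n - 3 \<le> (2 * real d + 1)\<^sup>2"
    by (simp add: power2_eq_square algebra_simps)
  then have "sqrt (4 * real n - 3) \<le> 2 * real d + 1"
    by (intro real_le_lsqrt) auto
  \<comment> \<open>As \<open>d\<close> is an integer, bounding the real number under the ceiling by
    \<open>d\<close> is enough.\<close>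
  then show ?thesis
    by (simp add: ceiling_le_iff d_def)
qed

end
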